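(* Let $\rho_1^{X_1B_1}$ and $\rho_2^{X_2B_2}$ be classical-quantum states $\rho_i^{X_iB_i}=\frac12|0\rangle\langle0|\otimes\sigma_0^{B_i}+\frac12|1\rangle\langle1|\otimes\sigma_1^{B_i}$, with $\sigma_0^{B_i},\sigma_1^{B_i}$ quantum states on a finite-dimensional system $B_i$ ($i=1,2$), and let $$\tau^{(X_1+X_2)X_2B_1B_2}=\sum_{x_1,x_2\in\{0,1\}}\tfrac14\,|x_1\oplus x_2\rangle\langle x_1\oplus x_2|\otimes|x_2\rangle\langle x_2|\otimes\sigma_{x_1}^{B_1}\otimes\sigma_{x_2}^{B_2}.$$ Then $$\bar H_{1/2}^\uparrow(X_2|X_1+X_2,B_1B_2)_\tau=\log\left(1+\Big(e^{\bar H_{1/2}^\uparrow(X_1|B_1)_{\rho_1}}-1\Big)\Big(e^{\bar H_{1/2}^\uparrow(X_2|B_2)_{\rho_2}}-1\Big)\right).$$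
   Context: For a finite-dimensional quantum state $\rho_{AB}$, $$\bar H^\uparrow_\alpha(A|B)_\rho=\frac{\alpha}{1-\alpha}\log\operatorname{Tr}\Big[\big(\operatorname{Tr}_A\rho_{AB}^\alpha\big)^{1/\alpha}\Big],$$ so that $\bar H_{1/2}^\uparrow(A|B)_\rho=\log\operatorname{Tr}\big[(\operatorname{Tr}_A\sqrt{\rho_{AB}})^2\big]$, with $\log$ the natural logarithm. In $\bar H_{1/2}^\uparrow(X_2|X_1+X_2,B_1B_2)_\tau$ the system $A$ is the second register $X_2$ of $\tau$ and the conditioning system consists of the first register $X_1+X_2$ together with $B_1B_2$. *)

theory Defs
  imports "HOL-Analysis.Analysis"
begin

text \<open>
  An operator on a finite-dimensional system with orthonormal basis indexed by \<open>'n\<close> is a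
  matrix of type \<open>complex ^ 'n ^ 'n\<close>, and the composite of systems \<open>'a\<close> and \<open>'b\<close> is indexed by
  \<open>'a \<times> 'b\<close>. A classical bit is indexed by the numeral type \<open>2\<close>, whose elements are \<open>0\<close> and \<open>1\<close>
  and whose addition is addition modulo 2, i.e. exclusive or.
\<close>

definition cadjoint :: "complex ^ 'n ^ 'm \<Rightarrow> complex ^ 'm ^ 'n"
  where "cadjoint A = map_matrix cnj (transpose A)"

definition unitary_matrix :: "complex ^ 'n ^ 'n \<Rightarrow> bool"
  where "unitary_matrix U \<longleftrightarrow> cadjoint U ** U = mat 1 \<and> U ** cadjoint U = mat 1"

definition psd_matrix :: "complex ^ 'n ^ 'n \<Rightarrow> bool"
  where "psd_matrix A \<longleftrightarrow>
    cadjoint A = A \<and> (\<forall>v. 0 \<le> Re (\<Sum>i\<in>UNIV. cnj (v $ i) * (A *v v) $ i))"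

definition quantum_state :: "complex ^ 'n ^ 'n \<Rightarrow> bool"
  where "quantum_state \<rho> \<longleftrightarrow> psd_matrix \<rho> \<and> trace \<rho> = 1"

definition diag_matrix :: "('n \<Rightarrow> complex) \<Rightarrow> complex ^ 'n ^ 'n"
  where "diag_matrix d = (\<chi> i j. if i = j then d i else 0)"

definition diagonalizes :: "complex ^ 'n ^ 'n \<Rightarrow> ('n \<Rightarrow> real) \<Rightarrow> complex ^ 'n ^ 'n \<Rightarrow> bool"
  where "diagonalizes U d A \<longleftrightarrow> unitary_matrix U \<and>
    A = U ** diag_matrix (\<lambda>i. complex_of_real (d i)) ** cadjoint U"

text \<open>
  The real power of a positive semidefinite matrix, by functional calculus: eigenvalues are
  raised to the power \<open>p\<close>. A diagonalization exists by the spectral theorem, and the lemma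
  \<open>mpowr_unique\<close> below shows that the result does not depend on its choice. On the eigenvalue 0
  the convention \<open>0 powr p = 0\<close> applies, which is the usual power for \<open>p > 0\<close>.
\<close>

definition mpowr :: "complex ^ 'n ^ 'n \<Rightarrow> real \<Rightarrow> complex ^ 'n ^ 'n"
  where "mpowr A p = (THE B. \<exists>U d. diagonalizes U d A \<and> (\<forall>i. 0 \<le> d i) \<and>
    B = U ** diag_matrix (\<lambda>i. complex_of_real (d i powr p)) ** cadjoint U)"

definition ketbra :: "'n \<Rightarrow> complex ^ 'n ^ 'n"
  where "ketbra x = (\<chi> i j. axis x 1 $ i * cnj (axis x 1 $ j))"

definition tensor :: "complex ^ 'a ^ 'a \<Rightarrow> complex ^ 'b ^ 'b \<Rightarrow> complex ^ ('a \<times> 'b) ^ ('a \<times> 'b)"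
    (infixr "\<otimes>\<^sub>m" 75)
  where "A \<otimes>\<^sub>m B = (\<chi> i j. A $ fst i $ fst j * B $ snd i $ snd j)"

definition ptrace1 :: "complex ^ ('a::finite \<times> 'b::finite) ^ ('a \<times> 'b) \<Rightarrow> complex ^ 'b ^ 'b"
  where "ptrace1 \<rho> = (\<chi> i j. \<Sum>a\<in>UNIV. \<rho> $ (a, i) $ (a, j))"

text \<open>
  The conditional entropy of the first factor given the second. The trace is real and
  nonnegative for positive semidefinite \<open>\<rho>\<close>, so taking \<open>Re\<close> only changes the type.
\<close>

definition H_up :: "real \<Rightarrow> complex ^ ('a::finite \<times> 'b::finite) ^ ('a \<times> 'b) \<Rightarrow> real"
  where "H_up \<alpha> \<rho> =
    \<alpha> / (1 - \<alpha>) * ln (Re (trace (mpowr (ptrace1 (mpowr \<rho> \<alpha>)) (1 / \<alpha>))))"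

text \<open>
  Moves the second of several registers to the front, so that in \<open>H_up \<alpha> (swap12 \<rho>)\<close> the second
  register is the system and the first one is conditioned on together with the remaining ones.
\<close>

definition swap12 ::
    "complex ^ ('a::finite \<times> 'b::finite \<times> 'c::finite) ^ ('a \<times> 'b \<times> 'c)
      \<Rightarrow> complex ^ ('b \<times> 'a \<times> 'c) ^ ('b \<times> 'a \<times> 'c)"
  where "swap12 \<rho> = (\<chi> i j. case (i, j) of
    ((b, a, c), (b', a', c')) \<Rightarrow> \<rho> $ (a, b, c) $ (a', b', c'))"

lemma mult_diag_entry:
  "(A ** diag_matrix d) $ i $ j = A $ i $ j * d j"
  "(diag_matrix d ** A) $ i $ j = d i * A $ i $ j"
  by (simp_all add: diag_matrix_def matrix_matrix_mult_def if_distrib if_distribR cong: if_cong)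

lemma mpowr_unique:
  assumes U: "diagonalizes U d A" and V: "diagonalizes V e A"
  shows "U ** diag_matrix (\<lambda>i. complex_of_real (d i powr p)) ** cadjoint U =
         V ** diag_matrix (\<lambda>i. complex_of_real (e i powr p)) ** cadjoint V"
proof -
  let ?D = "\<lambda>d. diag_matrix (\<lambda>i. complex_of_real (d i))"
  let ?P = "\<lambda>d. diag_matrix (\<lambda>i. complex_of_real (d i powr p))"
  have u: "cadjoint U ** U = mat 1" "U ** cadjoint U = mat 1"
    and v: "cadjoint V ** V = mat 1" "V ** cadjoint V = mat 1"
    using U V by (simp_all add: diagonalizes_def unitary_matrix_def)
  define W where "W = cadjoint V ** U"
  have "U ** ?D d ** cadjoint U = V ** ?D e ** cadjoint V"
    using U V by (simp add: diagonalizes_def)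
  then have "cadjoint V ** (U ** ?D d ** cadjoint U) ** U
      = cadjoint V ** (V ** ?D e ** cadjoint V) ** U"
    by simp
  moreover have "cadjoint V ** (U ** ?D d ** cadjoint U) ** U = W ** ?D d ** (cadjoint U ** U)"
    by (simp add: W_def matrix_mul_assoc)
  moreover have "cadjoint V ** (V ** ?D e ** cadjoint V) ** U = (cadjoint V ** V) ** ?D e ** W"
    by (simp add: W_def matrix_mul_assoc)
  ultimately have eq: "W ** ?D d = ?D e ** W"
    by (simp add: u v)
  have "W $ i $ j * complex_of_real (d j powr p) = complex_of_real (e i powr p) * W $ i $ j" for i j
  proof -
    have "W $ i $ j * complex_of_real (d j) = complex_of_real (e i) * W $ i $ j"
      using arg_cong[OF eq, of "\<lambda>M. M $ i $ j"] by (simp add: mult_diag_entry)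
    then show ?thesis by (cases "W $ i $ j = 0") (auto simp: mult.commute)
  qed
  then have "W ** ?P d = ?P e ** W"
    by (simp add: vec_eq_iff mult_diag_entry)
  then have "V ** (W ** ?P d) ** cadjoint U = V ** (?P e ** W) ** cadjoint U"
    by simp
  moreover have "V ** (W ** ?P d) ** cadjoint U = (V ** cadjoint V) ** (U ** ?P d ** cadjoint U)"
    by (simp add: W_def matrix_mul_assoc)
  moreover have "V ** (?P e ** W) ** cadjoint U
      = (V ** ?P e ** cadjoint V) ** (U ** cadjoint U)"
    by (simp add: W_def matrix_mul_assoc)
  ultimately show ?thesis by (simp add: u v)
qed

lemma mpowr_eq:
  assumes "diagonalizes U d A" "\<And>i. 0 \<le> d i"
  shows "mpowr A p = U ** diag_matrix (\<lambda>i. complex_of_real (d i powr p)) ** cadjoint U"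
  unfolding mpowr_def
  by (rule the_equality) (use assms mpowr_unique[OF _ assms(1)] in blast)+

end

theory Submission
  imports Defs
begin

text \<open>
  The square root of a block-diagonal tensor product is formed from the square roots \<open>a\<^sub>x\<close>, \<open>b\<^sub>x\<close>
  of the states, and \<open>Tr a\<^sub>x\<^sup>2 = Tr b\<^sub>x\<^sup>2 = 1\<close>. Expanding the squares gives
  \<open>exp H(X\<^sub>1|B\<^sub>1) = 1 + f\<close> and \<open>exp H(X\<^sub>2|B\<^sub>2) = 1 + g\<close> with the overlaps
  \<open>f = Tr (a\<^sub>0 a\<^sub>1)\<close> and \<open>g = Tr (b\<^sub>0 b\<^sub>1)\<close>, which are real and nonnegative. In the combined state
  the cross terms factorize, so that the trace is \<open>1 + f g\<close>.
\<close>

section \<open>Spectral theorem for Hermitian matrices\<close>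

text \<open>By compactness \<open>x \<bullet> f x\<close> attains a minimum on the unit sphere of
  \<open>V\<close>, and a minimizer is an eigenvector. Working in an invariant subspace allows
  repeated use on orthogonal complements; complex vectors enter as a real Euclidean space.\<close>

lemma selfadjoint_eigenvector_in_subspace:
  fixes f :: "'a::euclidean_space \<Rightarrow> 'a"
  assumes f: "linear f" and sym: "\<And>x y. f x \<bullet> y = x \<bullet> f y"
    and V: "subspace V" and inv: "\<And>x. x \<in> V \<Longrightarrow> f x \<in> V"
    and u: "u \<in> V" "u \<noteq> 0"
  obtains l v where "v \<in> V" "norm v = 1" "f v = l *\<^sub>R v"
proof -
  have "compact (V \<inter> sphere 0 1)"
    using V by (simp add: closed_subspace closed_Int_compact)
  moreover have "u /\<^sub>R norm u \<in> V \<inter> sphere 0 1"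
    using u V by (simp add: subspace_scale)
  moreover have "continuous_on (V \<inter> sphere 0 1) (\<lambda>x. x \<bullet> f x)"
    using f by (intro continuous_intros linear_continuous_on) (simp add: linear_conv_bounded_linear)
  ultimately have "\<exists>v\<in>V \<inter> sphere 0 1. \<forall>x\<in>V \<inter> sphere 0 1. v \<bullet> f v \<le> x \<bullet> f x"
    by (intro continuous_attains_inf) blast+
  then obtain v where v: "v \<in> V" "norm v = 1"
    and min: "\<And>x. x \<in> V \<Longrightarrow> norm x = 1 \<Longrightarrow> v \<bullet> f v \<le> x \<bullet> f x"
    by auto
  define l where "l = v \<bullet> f v"
  \<comment> \<open>The quadratic form shifted by its minimum \<open>l\<close>: by homogeneity it is
    nonnegative on all of \<open>V\<close>, and it vanishes at \<open>v\<close>.\<close>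
  define q where "q x = x \<bullet> f x - l * (x \<bullet> x)" for x
  have q_nonneg: "0 \<le> q x" if "x \<in> V" for x
  proof (cases "x = 0")
    case False
    have "l \<le> (x /\<^sub>R norm x) \<bullet> f (x /\<^sub>R norm x)"
      unfolding l_def using False that V by (intro min) (simp_all add: subspace_scale)
    also have "\<dots> = (x \<bullet> f x) / (norm x)\<^sup>2"
      using f by (simp add: linear_scale power2_eq_square field_simps)
    finally show ?thesis
      using False by (simp add: q_def field_simps power2_norm_eq_inner)
  qed (simp add: q_def f linear_0)
  define w where "w = f v - l *\<^sub>R v"
  define b where "b = w \<bullet> w"
  have w: "w \<in> V"
    unfolding w_def by (intro subspace_diff subspace_scale V inv v)
  \<comment> \<open>The minimum \<open>v\<close> of the nonnegative form \<open>q\<close> on \<open>V\<close> is a critical point: moving from it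
    by \<open>t *\<^sub>R w\<close> with small negative \<open>t\<close> would make \<open>q\<close> negative unless \<open>w = 0\<close>.\<close>
  have expand: "q (v + t *\<^sub>R w) = t * (2 * b + t * q w)" for t
  proof -
    have "v \<bullet> v = 1"
      using v by (simp add: norm_eq_1)
    moreover have "v \<bullet> f w = w \<bullet> f v"
      using sym[of v w] by (simp add: inner_commute)
    moreover have "w \<bullet> f v = b + l * (w \<bullet> v)"
      unfolding b_def by (subst (3) w_def) (simp add: inner_diff_right)
    ultimately show ?thesis
      using f by (simp add: q_def linear_add linear_scale inner_add_left inner_add_right
          inner_commute[of v w] l_def[symmetric] algebra_simps)
  qed
  define c where "c = q w"
  have c: "0 \<le> c"
    using q_nonneg[OF w] by (simp add: c_def)
  have "b = 0"
  proof (rule ccontr)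
    assume "b \<noteq> 0"
    then have b: "0 < b"
      by (simp add: b_def)
    \<comment> \<open>This \<open>t\<close> keeps the factor \<open>2 * b + t * c\<close> at or
      above \<open>b\<close>; the \<open>+ 1\<close> keeps the denominator positive when
      \<open>c = 0\<close>.\<close>
    define t where "t = - (b / (c + 1))"
    have "0 \<le> t * (2 * b + t * c)"
      using q_nonneg[of "v + t *\<^sub>R w"] v w V expand
      by (simp add: subspace_add subspace_scale c_def)
    moreover have "t < 0"
      using b c by (simp add: t_def)
    moreover have "b * c / (c + 1) \<le> b"
      using b c by (simp add: field_simps)
    then have "0 < 2 * b + t * c"
      using b by (simp add: t_def)
    ultimately show False
      by (simp add: zero_le_mult_iff)
  qed
  then have "f v = l *\<^sub>R v"
    by (simp add: b_def w_def)
  with v that show thesis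
    by blast
qed

text \<open>The Hermitian form behind unitarity; \<open>\<bullet>\<close> on complex vectors is only
  its real part.\<close>

definition cinner :: "complex ^ 'n \<Rightarrow> complex ^ 'n \<Rightarrow> complex"
  where "cinner v w = (\<Sum>i\<in>UNIV. cnj (v $ i) * w $ i)"

lemma cinner_simps:
  "cinner v (w + w') = cinner v w + cinner v w'"
  "cinner v (r *\<^sub>R w) = of_real r * cinner v w"
  "cinner (r *\<^sub>R v) w = of_real r * cinner v w"
  "cinner v 0 = 0"
  unfolding cinner_def
  by (simp_all add: sum.distrib sum_distrib_left algebra_simps scaleR_conv_of_real[where 'a=complex])

lemma cinner_commute: "cinner w v = cnj (cinner v w)"
  by (simp add: cinner_def mult.commute)

lemma inner_eq_Re_cinner: "v \<bullet> w = Re (cinner v w)"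
  by (simp add: cinner_def inner_vec_def inner_complex_def)

lemma cinner_eq_inner: "cinner v w = Complex (v \<bullet> w) ((\<i> *s v) \<bullet> w)"
  by (simp add: complex_eq_iff inner_eq_Re_cinner) (simp add: cinner_def)

lemma cinner_self: "cinner v v = of_real ((norm v)\<^sup>2)"
  by (simp add: cinner_eq_inner power2_norm_eq_inner complex_eq_iff)
    (simp add: inner_vec_def inner_complex_def)

lemma cinner_cadjoint: "cinner v (A *v w) = cinner (cadjoint A *v v) w"
proof -
  have "cinner v (A *v w) = (\<Sum>i\<in>UNIV. \<Sum>j\<in>UNIV. cnj (v $ i) * A $ i $ j * w $ j)"
    by (simp add: cinner_def matrix_vector_mult_def sum_distrib_left mult.assoc)
  also have "\<dots> = (\<Sum>j\<in>UNIV. \<Sum>i\<in>UNIV. cnj (v $ i) * A $ i $ j * w $ j)"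
    by (rule sum.swap)
  also have "\<dots> = cinner (cadjoint A *v v) w"
    by (simp add: cinner_def matrix_vector_mult_def cadjoint_def map_matrix_def transpose_def
        sum_distrib_left mult_ac)
  finally show ?thesis .
qed

lemma psd_matrix_iff: "psd_matrix A \<longleftrightarrow> cadjoint A = A \<and> (\<forall>v. 0 \<le> Re (cinner v (A *v v)))"
  by (simp add: psd_matrix_def cinner_def)

text \<open>Induction on the index set adds one eigenvector at a time: the complex orthogonal
  complement of those already found is invariant because \<open>A\<close> is Hermitian, and it is
  nonzero while an index is left.\<close>

lemma hermitian_orthonormal_eigenvectors:
  fixes A :: "complex ^ 'n ^ 'n" and I :: "'n set"
  assumes A: "cadjoint A = A"
  shows "\<exists>e d. \<forall>i\<in>I. A *v e i = d i *\<^sub>R e i \<and>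
    (\<forall>j\<in>I. cinner (e i) (e j) = (if i = j then 1 else 0))"
  using finite[of I]
proof (induction I)
  case (insert k I)
  then obtain e d where eig: "\<And>i. i \<in> I \<Longrightarrow> A *v e i = d i *\<^sub>R e i"
    and orth: "\<And>i j. i \<in> I \<Longrightarrow> j \<in> I \<Longrightarrow> cinner (e i) (e j) = (if i = j then 1 else 0)"
    by metis
  define V where "V = {w. \<forall>i\<in>I. cinner (e i) w = 0}"
  have V: "subspace V"
    by (auto simp: subspace_def V_def cinner_simps)
  have inv: "A *v w \<in> V" if "w \<in> V" for w
    using that by (auto simp: V_def cinner_cadjoint A eig cinner_simps)
  \<comment> \<open>Real orthogonality to both \<open>e i\<close> and \<open>\<i> *s e i\<close> is complex orthogonality to \<open>e i\<close>.\<close>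
  let ?S = "e ` I \<union> (\<lambda>i. \<i> *s e i) ` I"
  have "dim ?S \<le> card ?S"
    using insert.hyps by (intro dim_le_card') simp
  also have "\<dots> \<le> card I + card I"
    by (rule order_trans[OF card_Un_le add_mono]) (auto intro: card_image_le insert.hyps)
  \<comment> \<open>Strict because \<open>k\<close> lies outside \<open>I\<close>; the bound is the
    real dimension of \<open>complex ^ 'n\<close>.\<close>
  also have "\<dots> < 2 * CARD('n)"
    using insert.hyps psubset_card_mono[of UNIV I] by fastforce
  finally have "dim ?S < DIM(complex ^ 'n)"
    by (simp add: mult.commute)
  then obtain u where u: "u \<noteq> 0" "\<And>y. y \<in> span ?S \<Longrightarrow> orthogonal u y"
    using orthogonal_to_subspace_exists by blast
  have "u \<in> V"
  proof -
    have "cinner (e i) u = 0" if "i \<in> I" for i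
    proof -
      have "orthogonal u (e i)" "orthogonal u (\<i> *s e i)"
        using that by (auto intro!: u span_base)
      then show ?thesis
        by (simp add: cinner_eq_inner orthogonal_def inner_commute complex_eq_iff)
    qed
    then show ?thesis by (simp add: V_def)
  qed
  moreover have "linear ((*v) A)"
    by (intro linearI) (simp_all add: vec_eq_iff matrix_vector_mult_def scaleR_sum_right
        sum.distrib distrib_left)
  moreover have "(A *v x) \<bullet> y = x \<bullet> (A *v y)" for x y
    by (simp add: inner_eq_Re_cinner cinner_cadjoint A)
  ultimately obtain l v where v: "v \<in> V" "norm v = 1" "A *v v = l *\<^sub>R v"
    using selfadjoint_eigenvector_in_subspace[of "(*v) A" V u] V inv u(1) by metis
  have "cinner v v = 1"
    using v by (simp add: cinner_self)
  moreover have "cinner (e i) v = 0" "cinner v (e i) = 0" if "i \<in> I" for i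
    using v(1) that cinner_commute[of v "e i"] by (simp_all add: V_def)
  ultimately show ?case
    using v insert.hyps eig orth
    by (intro exI[of _ "e(k := v)"] exI[of _ "d(k := l)"]) auto
qed simp

text \<open>The orthonormal eigenvectors form the columns of \<open>U\<close>, so
  \<open>A ** U\<close> scales each column by its eigenvalue.\<close>

lemma hermitian_diagonalizes:
  fixes A :: "complex ^ 'n ^ 'n"
  assumes A: "cadjoint A = A"
  obtains U d where "diagonalizes U d A"
proof -
  obtain e :: "'n \<Rightarrow> complex ^ 'n" and d where eig: "\<And>i. A *v e i = d i *\<^sub>R e i"
    and orth: "\<And>i j. cinner (e i) (e j) = (if i = j then 1 else 0)"
    using hermitian_orthonormal_eigenvectors[OF A, of UNIV] by (metis UNIV_I)
  define U :: "complex ^ 'n ^ 'n" where "U = (\<chi> i j. e j $ i)"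
  have 1: "cadjoint U ** U = mat 1"
    using orth by (simp add: vec_eq_iff matrix_matrix_mult_def cadjoint_def map_matrix_def
        transpose_def mat_def U_def cinner_def)
  then have 2: "U ** cadjoint U = mat 1"
    by (simp add: matrix_left_right_inverse)
  have "(A ** U) $ i $ j = (U ** diag_matrix (\<lambda>i. of_real (d i))) $ i $ j" for i j
    using arg_cong[OF eig[of j], of "\<lambda>v. v $ i"] unfolding mult_diag_entry
    by (simp add: U_def matrix_matrix_mult_def matrix_vector_mult_def
        scaleR_conv_of_real[where 'a=complex] mult.commute)
  then have "A ** U ** cadjoint U = U ** diag_matrix (\<lambda>i. of_real (d i)) ** cadjoint U"
    by (metis vec_eq_iff)
  then have "A = U ** diag_matrix (\<lambda>i. of_real (d i)) ** cadjoint U"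
    by (simp add: matrix_mul_assoc[symmetric] 2)
  then show thesis
    using that 1 2 by (simp add: diagonalizes_def unitary_matrix_def)
qed

section \<open>Positive semidefinite matrices and their square roots\<close>

lemma cadjoint_simps [simp]:
  "cadjoint (A + B) = cadjoint A + cadjoint B"
  "cadjoint (r *\<^sub>R A) = r *\<^sub>R cadjoint A"
  "cadjoint (cadjoint A) = A"
  by (simp_all add: cadjoint_def map_matrix_def transpose_def vec_eq_iff)

lemma cadjoint_mult: "cadjoint (A ** B) = cadjoint B ** cadjoint A"
  by (simp add: cadjoint_def map_matrix_def transpose_def vec_eq_iff matrix_matrix_mult_def
      mult.commute)

lemma cadjoint_diag_matrix:
  "cadjoint (diag_matrix (\<lambda>i. of_real (d i))) = diag_matrix (\<lambda>i. of_real (d i))"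
  by (auto simp: cadjoint_def map_matrix_def transpose_def vec_eq_iff diag_matrix_def)

lemma diag_matrix_mult: "diag_matrix c ** diag_matrix d = diag_matrix (\<lambda>i. c i * d i)"
  by (simp add: vec_eq_iff mult_diag_entry) (simp add: diag_matrix_def)

lemma diag_matrix_vector_mult: "(diag_matrix d *v x) $ i = d i * x $ i"
  by (simp add: matrix_vector_mult_def diag_matrix_def mult_delta_left)

lemma cinner_axis: "cinner (axis i 1) v = v $ i"
proof -
  have "cnj (axis i 1 $ j) * v $ j = (if i = j then v $ j else 0)" for j
    by (simp add: axis_def)
  then show ?thesis
    by (simp add: cinner_def)
qed

text \<open>The form at \<open>v\<close> is the squared norm of \<open>C *v v\<close>. Positivity of
  tensor products and projectors is later read off such a factorization.\<close>

lemma psd_matrix_cadjoint_mult: "psd_matrix (cadjoint C ** C)"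
proof -
  have "cinner v ((cadjoint C ** C) *v v) = cinner (C *v v) (C *v v)" for v
    using cinner_cadjoint[of v "cadjoint C" "C *v v"] by (simp add: matrix_vector_mul_assoc)
  then show ?thesis
    by (simp add: psd_matrix_iff cadjoint_mult cinner_self)
qed

lemma psd_matrix_add: "psd_matrix A \<Longrightarrow> psd_matrix B \<Longrightarrow> psd_matrix (A + B)"
  by (simp add: psd_matrix_iff matrix_vector_mult_add_rdistrib cinner_simps)

lemma psd_matrix_scaleR: "0 \<le> r \<Longrightarrow> psd_matrix A \<Longrightarrow> psd_matrix (r *\<^sub>R A)"
proof -
  have "(r *\<^sub>R A) *v v = r *\<^sub>R (A *v v)" for v
    by (simp add: vec_eq_iff matrix_vector_mult_def scaleR_sum_right)
  then show "0 \<le> r \<Longrightarrow> psd_matrix A \<Longrightarrow> psd_matrix (r *\<^sub>R A)"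
    by (simp add: psd_matrix_iff cinner_simps)
qed

text \<open>An eigenvalue is the value of the quadratic form at its unit eigenvector, a column of
  \<open>U\<close>.\<close>

lemma psd_diagonalizes:
  assumes A: "psd_matrix A"
  obtains U d where "diagonalizes U d A" "\<And>i. 0 \<le> d i"
proof -
  obtain U d where U: "diagonalizes U d A"
    using A hermitian_diagonalizes by (auto simp: psd_matrix_iff)
  have "0 \<le> d i" for i
  proof -
    have uu: "cadjoint U ** U = mat 1"
      and eq: "A = U ** diag_matrix (\<lambda>i. of_real (d i)) ** cadjoint U"
      using U by (simp_all add: diagonalizes_def unitary_matrix_def)
    define v where "v = U *v axis i 1"
    have *: "cadjoint U *v v = axis i 1"
      by (simp add: v_def matrix_vector_mul_assoc uu)
    have "cinner v (A *v v)
        = cinner v (U *v (diag_matrix (\<lambda>i. of_real (d i)) *v (cadjoint U *v v)))"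
      unfolding eq by (simp add: matrix_vector_mul_assoc matrix_mul_assoc)
    also have "\<dots> = cinner (axis i 1) (diag_matrix (\<lambda>i. of_real (d i)) *v axis i 1)"
      unfolding cinner_cadjoint[of v U] * ..
    also have "\<dots> = of_real (d i)"
      by (simp add: cinner_axis diag_matrix_vector_mult)
    finally show ?thesis
      using A by (metis Re_complex_of_real psd_matrix_iff)
  qed
  with U that show thesis by blast
qed

lemma diagonal_mult:
  assumes "unitary_matrix U"
  shows "(U ** diag_matrix c ** cadjoint U) ** (U ** diag_matrix d ** cadjoint U)
    = U ** diag_matrix (\<lambda>i. c i * d i) ** cadjoint U"
proof -
  have "(U ** diag_matrix c ** cadjoint U) ** (U ** diag_matrix d ** cadjoint U)
      = U ** diag_matrix c ** (cadjoint U ** U) ** diag_matrix d ** cadjoint U"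
    by (simp add: matrix_mul_assoc)
  also have "\<dots> = U ** (diag_matrix c ** diag_matrix d) ** cadjoint U"
    using assms by (simp add: unitary_matrix_def matrix_mul_assoc)
  finally show ?thesis
    by (simp add: diag_matrix_mult)
qed

lemma psd_matrix_diagonal:
  assumes "\<And>i. 0 \<le> d i"
  shows "psd_matrix (U ** diag_matrix (\<lambda>i. of_real (d i)) ** cadjoint U)"
proof -
  define C where "C = diag_matrix (\<lambda>i. of_real (sqrt (d i))) ** cadjoint U"
  have "diag_matrix (\<lambda>i. complex_of_real (d i))
      = diag_matrix (\<lambda>i. of_real (sqrt (d i))) ** diag_matrix (\<lambda>i. of_real (sqrt (d i)))"
    using assms by (simp add: diag_matrix_mult flip: of_real_mult)
  then have "U ** diag_matrix (\<lambda>i. of_real (d i)) ** cadjoint U = cadjoint C ** C"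
    by (simp add: C_def cadjoint_mult cadjoint_diag_matrix matrix_mul_assoc)
  then show ?thesis
    by (simp add: psd_matrix_cadjoint_mult)
qed

lemma psd_sqrt_exists:
  assumes "psd_matrix A"
  obtains B where "psd_matrix B" "B ** B = A"
proof -
  obtain U d where U: "diagonalizes U d A" and d: "\<And>i. 0 \<le> d i"
    using psd_diagonalizes[OF assms] by blast
  let ?B = "U ** diag_matrix (\<lambda>i. of_real (sqrt (d i))) ** cadjoint U"
  have "?B ** ?B = A"
    using U d by (simp add: diagonalizes_def diagonal_mult flip: of_real_mult)
  moreover have "psd_matrix ?B"
    using d by (intro psd_matrix_diagonal) simp
  ultimately show thesis
    using that by blast
qed

lemma mpowr_two:
  assumes "psd_matrix A"
  shows "mpowr A 2 = A ** A"
proof -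
  obtain U d where U: "diagonalizes U d A" and d: "\<And>i. 0 \<le> d i"
    using psd_diagonalizes[OF assms] by blast
  then have "mpowr A 2 = U ** diag_matrix (\<lambda>i. of_real (d i) * of_real (d i)) ** cadjoint U"
    by (simp add: mpowr_eq powr_numeral power2_eq_square)
  also have "\<dots> = A ** A"
    using U by (simp add: diagonalizes_def diagonal_mult)
  finally show ?thesis .
qed

text \<open>The unitary that diagonalizes \<open>B\<close> also diagonalizes \<open>B ** B\<close>,
  with squared eigenvalues. Hence any positive semidefinite root that can be exhibited is the power
  1/2, and composite states need not be diagonalized.\<close>

lemma mpowr_half_square:
  assumes "psd_matrix B"
  shows "mpowr (B ** B) (1/2) = B"
proof -
  obtain U d where U: "diagonalizes U d B" and d: "\<And>i. 0 \<le> d i"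
    using psd_diagonalizes[OF assms] by blast
  have "diagonalizes U (\<lambda>i. d i * d i) (B ** B)"
    using U by (simp add: diagonalizes_def diagonal_mult)
  then have "mpowr (B ** B) (1/2)
      = U ** diag_matrix (\<lambda>i. of_real ((d i * d i) powr (1/2))) ** cadjoint U"
    by (rule mpowr_eq) simp
  also have "\<dots> = B"
    using U d by (simp add: powr_half_sqrt diagonalizes_def)
  finally show ?thesis .
qed

text \<open>By cyclicity the trace is the squared Hilbert-Schmidt norm of the product of the two
  square roots.\<close>

lemma trace_psd_mult_nonneg:
  assumes "psd_matrix A" "psd_matrix B"
  obtains f where "0 \<le> f" "trace (A ** B) = complex_of_real f"
proof -
  obtain C D where C: "psd_matrix C" "C ** C = A" and D: "psd_matrix D" "D ** D = B"
    using assms psd_sqrt_exists by metis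
  define X where "X = D ** C"
  have "trace (A ** B) = trace (C ** (C ** D ** D))"
    by (simp add: C(2)[symmetric] D(2)[symmetric] matrix_mul_assoc)
  also have "\<dots> = trace (C ** D ** (D ** C))"
    by (subst trace_mul_sym) (simp add: matrix_mul_assoc)
  also have "\<dots> = trace (cadjoint X ** X)"
    using C D by (simp add: X_def cadjoint_mult psd_matrix_iff)
  also have "\<dots> = of_real (\<Sum>i\<in>UNIV. \<Sum>j\<in>UNIV. (cmod (X $ j $ i))\<^sup>2)"
    by (simp add: trace_def matrix_matrix_mult_def cadjoint_def map_matrix_def transpose_def
        mult.commute[of "cnj _"] complex_norm_square del: of_real_power)
  finally show thesis
    by (rule that[rotated]) (intro sum_nonneg, simp)
qed

section \<open>Tensor products\<close>

lemma sum_UNIV_prod: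
  fixes g :: "'a::finite \<times> 'b::finite \<Rightarrow> complex"
  shows "sum g UNIV = (\<Sum>a\<in>UNIV. \<Sum>b\<in>UNIV. g (a, b))"
  by (simp add: sum.cartesian_product)

lemma tensor_mult: "(A \<otimes>\<^sub>m B) ** (C \<otimes>\<^sub>m D) = (A ** C) \<otimes>\<^sub>m (B ** D)"
  by (simp add: vec_eq_iff tensor_def matrix_matrix_mult_def sum_UNIV_prod sum_product mult_ac)

lemma tensor_zero [simp]: "0 \<otimes>\<^sub>m A = 0" "A \<otimes>\<^sub>m 0 = 0"
  by (simp_all add: vec_eq_iff tensor_def)

lemma trace_tensor: "trace (A \<otimes>\<^sub>m B) = trace A * trace B"
  by (simp add: tensor_def trace_def sum_UNIV_prod sum_product)

lemma cadjoint_tensor: "cadjoint (A \<otimes>\<^sub>m B) = cadjoint A \<otimes>\<^sub>m cadjoint B"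
  by (simp add: vec_eq_iff tensor_def cadjoint_def map_matrix_def transpose_def)

lemma psd_matrix_tensor:
  assumes "psd_matrix A" "psd_matrix B"
  shows "psd_matrix (A \<otimes>\<^sub>m B)"
proof -
  obtain C D where C: "psd_matrix C" "C ** C = A" and D: "psd_matrix D" "D ** D = B"
    using assms psd_sqrt_exists by metis
  then have "A \<otimes>\<^sub>m B = cadjoint (C \<otimes>\<^sub>m D) ** (C \<otimes>\<^sub>m D)"
    by (simp add: cadjoint_tensor tensor_mult psd_matrix_iff)
  then show ?thesis
    by (simp add: psd_matrix_cadjoint_mult)
qed

lemma ketbra_nth: "ketbra x $ i $ j = (if i = x then if j = x then 1 else 0 else 0)"
  by (simp add: ketbra_def axis_def)

lemma ketbra_mult: "ketbra x ** ketbra y = (if x = y then ketbra x else 0)"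
proof -
  have ketbra_diag: "ketbra z = diag_matrix (\<lambda>i. if i = z then 1 else 0)" for z :: 'a
    by (auto simp: vec_eq_iff ketbra_nth diag_matrix_def)
  show ?thesis
    unfolding ketbra_diag diag_matrix_mult by (auto simp: vec_eq_iff diag_matrix_def)
qed

lemma trace_ketbra: "trace (ketbra x) = 1"
  by (simp add: trace_def ketbra_nth)

lemma psd_matrix_ketbra: "psd_matrix (ketbra x)"
proof -
  have "cadjoint (ketbra x) = ketbra x"
    by (simp add: vec_eq_iff ketbra_nth cadjoint_def map_matrix_def transpose_def)
  then show ?thesis
    using psd_matrix_cadjoint_mult[of "ketbra x"] by (simp add: ketbra_mult)
qed

lemma ptrace1_simps:
  "ptrace1 (A + B) = ptrace1 A + ptrace1 B"
  "ptrace1 (r *\<^sub>R A) = r *\<^sub>R ptrace1 A"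
  "ptrace1 (ketbra x \<otimes>\<^sub>m M) = M"
  by (simp_all add: vec_eq_iff ptrace1_def sum.distrib scaleR_sum_right tensor_def ketbra_nth
      mult_delta_left)

lemma swap12_simps:
  "swap12 (A + B) = swap12 A + swap12 B"
  "swap12 (r *\<^sub>R A) = r *\<^sub>R swap12 A"
  "swap12 (C \<otimes>\<^sub>m D \<otimes>\<^sub>m E) = D \<otimes>\<^sub>m C \<otimes>\<^sub>m E"
  by (simp_all add: vec_eq_iff swap12_def tensor_def)

section \<open>The entropies\<close>

text \<open>At \<alpha> = 1/2 the prefactor is 1 and the outer power is a square, so the entropy is
  explicit once a root \<open>S\<close> of the state is known.\<close>

lemma H_up_half:
  assumes "psd_matrix S" "psd_matrix (ptrace1 S)" "S ** S = \<rho>"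
  shows "H_up (1/2) \<rho> = ln (Re (trace (ptrace1 S ** ptrace1 S)))"
  unfolding assms(3)[symmetric] using assms(1,2)
  by (simp add: H_up_def mpowr_half_square[simplified] mpowr_two)

lemma matrix_scaleR_mult:
  fixes A :: "complex ^ 'n ^ 'm" and B :: "complex ^ 'k ^ 'n"
  shows "(r *\<^sub>R A) ** B = r *\<^sub>R (A ** B)" "A ** (r *\<^sub>R B) = r *\<^sub>R (A ** B)"
  by (simp_all add: vec_eq_iff matrix_matrix_mult_def scaleR_sum_right)

lemma matrix_add_mult:
  fixes A :: "complex ^ 'n ^ 'm" and B :: "complex ^ 'k ^ 'n"
  shows "(A + A') ** B = A ** B + A' ** B" "A ** (B + B') = A ** B + A ** B'"
  by (simp_all add: vec_eq_iff matrix_matrix_mult_def sum.distrib algebra_simps)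

lemma trace_scaleR: "trace (r *\<^sub>R A) = of_real r * trace (A :: complex ^ 'n ^ 'n)"
  by (simp add: trace_def scaleR_sum_right scaleR_conv_of_real[where 'a=complex] sum_distrib_left)

lemmas matrix_expand = matrix_add_mult matrix_scaleR_mult tensor_mult ketbra_mult
  trace_add trace_scaleR trace_tensor trace_ketbra

text \<open>Taking the roots \<open>s x\<close> as data, the trace is that of
  \<open>(s 0 + s 1)\<close> squared, halved: two unit terms and two equal overlaps
  \<open>f\<close>.\<close>

lemma exp_H_up_half_cq:
  fixes s :: "2 \<Rightarrow> complex ^ 'b ^ 'b"
  assumes psd: "\<And>x. psd_matrix (s x)" and tr: "\<And>x. trace (s x ** s x) = 1"
    and f: "trace (s 0 ** s 1) = of_real f" "0 \<le> f"
  shows "exp (H_up (1/2) ((1/2) *\<^sub>R (ketbra (0::2) \<otimes>\<^sub>m (s 0 ** s 0))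
    + (1/2) *\<^sub>R (ketbra 1 \<otimes>\<^sub>m (s 1 ** s 1)))) = 1 + f"
    (is "exp (H_up _ ?\<rho>) = _")
proof -
  \<comment> \<open>The root of the weight 1/2 of each block.\<close>
  define r :: real where "r = sqrt (1/2)"
  have r: "0 \<le> r" "r * r = 1/2"
    by (simp_all add: r_def)
  define S where "S = r *\<^sub>R (ketbra (0::2) \<otimes>\<^sub>m s 0 + ketbra 1 \<otimes>\<^sub>m s 1)"
  have "psd_matrix S"
    unfolding S_def
    by (intro psd_matrix_scaleR psd_matrix_add psd_matrix_tensor psd psd_matrix_ketbra r)
  moreover have P: "ptrace1 S = r *\<^sub>R (s 0 + s 1)"
    by (simp add: S_def ptrace1_simps)
  then have "psd_matrix (ptrace1 S)"
    by (auto intro!: psd_matrix_scaleR psd_matrix_add psd r)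
  \<comment> \<open>The cross terms vanish because the two projectors on the bit are
    orthogonal.\<close>
  moreover have "S ** S = ?\<rho>"
    by (simp add: S_def matrix_expand r scaleR_add_right)
  ultimately have "H_up (1/2) ?\<rho> = ln (Re (trace (ptrace1 S ** ptrace1 S)))"
    by (rule H_up_half)
  also have "trace (ptrace1 S ** ptrace1 S) = of_real (r * r * (2 + 2 * f))"
    using trace_mul_sym[of "s 1" "s 0"] f by (simp add: P matrix_expand tr algebra_simps)
  also have "r * r * (2 + 2 * f) = 1 + f"
    by (simp add: r)
  \<comment> \<open>\<open>f \<ge> 0\<close> makes \<open>1 + f\<close> positive, so
    \<open>exp\<close> undoes \<open>ln\<close>.\<close>
  finally show ?thesis
    using f by simp
qed

theorem propositionV4:
  fixes \<sigma>1 :: "2 \<Rightarrow> complex ^ 'b1 ^ 'b1"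
    and \<sigma>2 :: "2 \<Rightarrow> complex ^ 'b2 ^ 'b2"
    and \<rho>1 :: "complex ^ (2 \<times> 'b1) ^ (2 \<times> 'b1)"
    and \<rho>2 :: "complex ^ (2 \<times> 'b2) ^ (2 \<times> 'b2)"
    and \<tau> :: "complex ^ (2 \<times> 2 \<times> 'b1 \<times> 'b2) ^ (2 \<times> 2 \<times> 'b1 \<times> 'b2)"
  assumes "quantum_state (\<sigma>1 0)" and "quantum_state (\<sigma>1 1)"
    and "quantum_state (\<sigma>2 0)" and "quantum_state (\<sigma>2 1)"
    and "\<rho>1 = (1/2) *\<^sub>R (ketbra 0 \<otimes>\<^sub>m \<sigma>1 0) + (1/2) *\<^sub>R (ketbra 1 \<otimes>\<^sub>m \<sigma>1 1)"
    and "\<rho>2 = (1/2) *\<^sub>R (ketbra 0 \<otimes>\<^sub>m \<sigma>2 0) + (1/2) *\<^sub>R (ketbra 1 \<otimes>\<^sub>m \<sigma>2 1)"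
    and "\<tau> = (\<Sum>x1\<in>{0,1}. \<Sum>x2\<in>{0,1}.
           (1/4) *\<^sub>R (ketbra (x1 + x2) \<otimes>\<^sub>m ketbra x2 \<otimes>\<^sub>m \<sigma>1 x1 \<otimes>\<^sub>m \<sigma>2 x2))"
  shows "H_up (1/2) (swap12 \<tau>)
       = ln (1 + (exp (H_up (1/2) \<rho>1) - 1) * (exp (H_up (1/2) \<rho>2) - 1))"
proof -
  \<comment> \<open>\<open>exhaust_2\<close> lists the elements as 1 and 2, and 2 is the bit
    0.\<close>
  have two: "(2::2) = 0"
    by simp
  have bit: "x = 0 \<or> x = 1" for x :: 2
    using exhaust_2[of x] two by metis
  have states: "quantum_state (\<sigma>1 x)" "quantum_state (\<sigma>2 x)" for x
    using assms(1-4) bit[of x] by auto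
  then have "\<exists>s. psd_matrix s \<and> s ** s = \<sigma>1 x" "\<exists>s. psd_matrix s \<and> s ** s = \<sigma>2 x" for x
    using psd_sqrt_exists unfolding quantum_state_def by metis+
  then obtain a b where a: "\<And>x. psd_matrix (a x)" "\<And>x. a x ** a x = \<sigma>1 x"
    and b: "\<And>x. psd_matrix (b x)" "\<And>x. b x ** b x = \<sigma>2 x"
    by metis
  have tr: "trace (a x ** a x) = 1" "trace (b x ** b x) = 1" for x
    using states by (simp_all add: a b quantum_state_def)
  obtain f where f: "0 \<le> f" "trace (a 0 ** a 1) = of_real f"
    using trace_psd_mult_nonneg a by metis
  obtain g where g: "0 \<le> g" "trace (b 0 ** b 1) = of_real g"
    using trace_psd_mult_nonneg b by metis
  \<comment> \<open>\<open>T x y\<close> is the root of the unweighted block for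
    \<open>x1 = x\<close> and \<open>x2 = y\<close>, without the register of \<open>x2\<close>; that
    register comes first in \<open>S\<close>, as in \<open>swap12 \<tau>\<close>. The factor 1/2 in
    \<open>S\<close> is the root of the weight 1/4.\<close>
  define T where "T x y = ketbra (x + y) \<otimes>\<^sub>m a x \<otimes>\<^sub>m b y" for x y
  define S where "S = (1/2) *\<^sub>R (ketbra (0::2) \<otimes>\<^sub>m T 0 0 + ketbra 1 \<otimes>\<^sub>m T 0 1
    + ketbra 0 \<otimes>\<^sub>m T 1 0 + ketbra 1 \<otimes>\<^sub>m T 1 1)"
  have T: "psd_matrix (T x y)" for x y
    unfolding T_def by (intro psd_matrix_tensor psd_matrix_ketbra a b)
  have "psd_matrix S"
    unfolding S_def
    by (intro psd_matrix_scaleR psd_matrix_add psd_matrix_tensor T psd_matrix_ketbra) simp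
  moreover have P: "ptrace1 S = (1/2) *\<^sub>R (T 0 0 + T 0 1 + T 1 0 + T 1 1)"
    by (simp add: S_def ptrace1_simps)
  then have "psd_matrix (ptrace1 S)"
    by (auto intro!: psd_matrix_scaleR psd_matrix_add T)
  \<comment> \<open>The bits \<open>y\<close> and \<open>x + y\<close> determine \<open>x\<close>
    and \<open>y\<close>, so the four blocks of \<open>S\<close> are mutually orthogonal.\<close>
  moreover have "S ** S = swap12 \<tau>"
    by (simp add: S_def T_def assms(7) swap12_simps matrix_expand a b scaleR_add_right add_ac)
  ultimately have "H_up (1/2) (swap12 \<tau>) = ln (Re (trace (ptrace1 S ** ptrace1 S)))"
    by (rule H_up_half)
  \<comment> \<open>Products of two blocks now survive exactly when their values of
    \<open>x + y\<close> agree: four squares of trace 1, and four mixed products, in which both bits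
    are flipped, of trace \<open>f * g\<close>. The prefactor is 1/4.\<close>
  also have "trace (ptrace1 S ** ptrace1 S) = of_real (1 + f * g)"
    using trace_mul_sym[of "a 1" "a 0"] trace_mul_sym[of "b 1" "b 0"] f g
    by (simp add: P T_def matrix_expand tr)
  finally have "H_up (1/2) (swap12 \<tau>) = ln (1 + f * g)"
    by simp
  moreover have "exp (H_up (1/2) \<rho>1) = 1 + f"
    using exp_H_up_half_cq[of a f] a tr f by (simp add: assms(5))
  moreover have "exp (H_up (1/2) \<rho>2) = 1 + g"
    using exp_H_up_half_cq[of b g] b tr g by (simp add: assms(6))
  ultimately show ?thesis
    by simp
qed

end
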